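(* For all integers $L\ge 1$, $$G\left(L-1,L+1,5,\tfrac{5}{2},6,q\right)\geq0.$$
   Context: $\mathbf N$ denotes the set of nonnegative integers. For $m\in\mathbf N$, $(q)_m=\prod_{j=1}^m(1-q^j)$, with $(q)_0=1$. The $q$-binomial coefficient is $\begin{bmatrix} m+n\\ m\end{bmatrix}_q=\frac{(q)_{m+n}}{(q)_m(q)_n}$ if $m,n\in\mathbf N$, and it is $0$ otherwise (so $\begin{bmatrix} A\\ B\end{bmatrix}_q=0$ unless $0\le B\le A$). Define $$G(N,M,\alpha,\beta,K,q)=\sum_{j=-\infty}^\infty(-1)^j q^{Kj\frac{(\alpha+\beta)j+(\alpha-\beta)}{2}}\begin{bmatrix} N+M\\ N-Kj\end{bmatrix}_q .$$ The notation $P(q)\ge 0$ means that $P(q)$ is a polynomial in $q$ with nonnegative coefficients. *)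

theory Defs
  imports "HOL-Computational_Algebra.Polynomial" "HOL-Library.Poly_Mapping"
begin

definition qfac :: "nat \<Rightarrow> int poly" where
  "qfac m = (\<Prod>j=1..m. 1 - monom 1 j)"

text \<open>The division below is exact, see \<open>qbinom_mult\<close>.\<close>

definition qbinom :: "int \<Rightarrow> int \<Rightarrow> int poly" where
  "qbinom A B = (if 0 \<le> B \<and> B \<le> A
     then qfac (nat A) div (qfac (nat B) * qfac (nat (A - B))) else 0)"

text \<open>
  Since \<open>\<alpha>\<close> and \<open>\<beta>\<close> may be fractions, the exponents of \<open>q\<close> in \<open>G\<close> are a priori rational
  numbers, possibly negative. So \<open>G\<close> takes its values in the ring of finite integer
  combinations of formal powers \<open>q^e\<close> with \<open>e\<close> rational; \<open>Poly_Mapping.single e c\<close> is \<open>c q^e\<close>.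
\<close>

type_synonym qexpr = "rat \<Rightarrow>\<^sub>0 int"

definition qexpr_of_poly :: "int poly \<Rightarrow> qexpr" where
  "qexpr_of_poly p = (\<Sum>i\<le>degree p. Poly_Mapping.single (of_nat i) (coeff p i))"

text \<open>
  \<open>Sum_any\<close> sums over all integers \<open>j\<close>, and is meaningful because only finitely many terms
  are nonzero when \<open>K \<noteq> 0\<close>, see \<open>finite_G_support\<close>.
\<close>

definition G :: "int \<Rightarrow> int \<Rightarrow> rat \<Rightarrow> rat \<Rightarrow> int \<Rightarrow> qexpr" where
  "G N M \<alpha> \<beta> K = Sum_any (\<lambda>j::int.
     Poly_Mapping.single
       (of_int K * of_int j * (((\<alpha> + \<beta>) * of_int j + (\<alpha> - \<beta>)) / 2)) ((-1) ^ nat \<bar>j\<bar>)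
     * qexpr_of_poly (qbinom (N + M) (N - K * j)))"

definition nonneg_polynomial :: "qexpr \<Rightarrow> bool" where
  "nonneg_polynomial P \<longleftrightarrow>
     (\<exists>p :: int poly. P = qexpr_of_poly p \<and> (\<forall>i. coeff p i \<ge> 0))"

lemma qfac_Suc: "qfac (Suc m) = (1 - monom 1 (Suc m)) * qfac m"
  by (simp add: qfac_def mult.commute)

lemma qfac_nonzero: "qfac m \<noteq> 0"
proof -
  have "1 - monom (1::int) j \<noteq> 0" if "j \<ge> 1" for j
  proof
    assume "1 - monom (1::int) j = 0"
    then have "coeff (1 - monom (1::int) j) 0 = 0" by simp
    with that show False by simp
  qed
  then show ?thesis by (auto simp: qfac_def)
qed

lemma qfac_dvd: "qfac m * qfac n dvd qfac (m + n)"
proof (induction "m + n" arbitrary: m n rule: less_induct)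
  case less
  show ?case
  proof (cases "m = 0 \<or> n = 0")
    case True
    then show ?thesis by (auto simp: qfac_def)
  next
    case False
    then obtain a b where ab: "m = Suc a" "n = Suc b"
      by (meson not0_implies_Suc)
    have 1: "qfac a * qfac n dvd qfac (a + n)" and 2: "qfac m * qfac b dvd qfac (m + b)"
      using less[of a n] less[of m b] ab by auto
    have split: "1 - monom (1::int) (m + n)
        = (1 - monom 1 m) + monom 1 m * (1 - monom 1 n)"
      by (simp add: algebra_simps mult_monom)
    have eq: "qfac (m + n) = (1 - monom 1 m) * qfac (a + n)
        + monom 1 m * ((1 - monom 1 n) * qfac (m + b))"
      
    proof -
      have "qfac (m + n) = (1 - monom 1 (m + n)) * qfac (a + n)"
        using qfac_Suc[of "a + n"] ab by simp
      also have "\<dots> = (1 - monom 1 m) * qfac (a + n) + monom 1 m * (1 - monom 1 n) * qfac (a + n)"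
        unfolding split by (rule distrib_right)
      finally have "qfac (m + n) =
        (1 - monom 1 m) * qfac (a + n) + monom 1 m * (1 - monom 1 n) * qfac (a + n)" .
      moreover have "a + n = m + b" using ab by simp
      ultimately show ?thesis by (simp only: mult.assoc)
    qed
    have "qfac m * qfac n dvd (1 - monom 1 m) * qfac (a + n)"
      using mult_dvd_mono[OF dvd_refl 1, of "1 - monom 1 m"] ab
      by (simp add: qfac_Suc[of a] mult.assoc)
    moreover have "qfac m * qfac n dvd (1 - monom 1 n) * qfac (m + b)"
      using mult_dvd_mono[OF dvd_refl 2, of "1 - monom 1 n"] ab
      by (simp add: qfac_Suc[of b] mult.left_commute)
    ultimately show ?thesis unfolding eq by (simp add: dvd_add)
  qed
qed

lemma qbinom_mult:
  "qbinom (int m + int n) (int m) * (qfac m * qfac n) = qfac (m + n)"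
  using qfac_dvd[of m n] by (simp add: qbinom_def nat_int_add)

lemma finite_G_support:
  assumes "K \<noteq> 0"
  shows "finite {j::int. qbinom (N + M) (N - K * j) \<noteq> 0}"
proof (rule finite_subset)
  show "{j. qbinom (N + M) (N - K * j) \<noteq> 0} \<subseteq> (\<lambda>j. N - K * j) -` {0..N + M}"
    by (auto simp: qbinom_def split: if_splits)
  show "finite ((\<lambda>j. N - K * j) -` {0..N + M})"
    using assms by (intro finite_vimageI) (auto simp: inj_on_def)
qed

lemma lookup_qexpr_of_poly: "Poly_Mapping.lookup (qexpr_of_poly p) (of_nat i) = coeff p i"
  by (simp add: qexpr_of_poly_def lookup_sum lookup_single when_def coeff_eq_0)

end

theory Submission imports Defs begin

text \<open>
  With \<open>r = 6 j + 1\<close> the \<open>j\<close>-th term of \<open>G\<close> is \<open>(-1)^j q^(5 (r^2 - 1) / 8) [2 L, L - r]\<close>.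
  Applying the \<open>q\<close>-Vandermonde sum twice gives, for odd \<open>r\<close>, an expansion of
  \<open>q^((r^2 - 1) / 2) [2 L, L - r]\<close> in the \<open>q\<close>-binomials \<open>[s, (s - r) / 2]\<close> with \<open>s\<close> odd, whose
  coefficients do not depend on \<open>r\<close> and are nonnegative. What remains, with \<open>s = 2 m + 1\<close>,
  is to sum \<open>(-1)^j q^(3 j (3 j + 1) / 2) [2 m + 1, m - 3 j]\<close> over all \<open>j\<close>, and the result is
  the product of the factors \<open>1 + q^i + q^(2 i)\<close> for \<open>i\<close> from 1 to \<open>m\<close>.
\<close>

section \<open>Gaussian binomials\<close>

text \<open>Natural-number indices make induction direct and leave \<open>n < k\<close> as the only
  vanishing case.\<close>

definition gauss :: "nat \<Rightarrow> nat \<Rightarrow> int poly" where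
  "gauss n k = qbinom (int n) (int k)"

lemma gauss_eq_0: "n < k \<Longrightarrow> gauss n k = 0"
  by (simp add: gauss_def qbinom_def)

lemma gauss_qfac: "gauss (m + n) m * (qfac m * qfac n) = qfac (m + n)"
  using qbinom_mult[of m n] by (simp add: gauss_def)

text \<open>Cancelling nonzero factorials in an integral domain avoids any reasoning about
  \<open>div\<close>.\<close>

lemma gauss_eqI:
  assumes "p * (qfac m * qfac n) = qfac (m + n)"
  shows "gauss (m + n) m = p"
  using assms gauss_qfac[of m n] qfac_nonzero[of m] qfac_nonzero[of n]
  by (metis mult_cancel_right mult_eq_0_iff)

lemma gauss_0 [simp]: "gauss n 0 = 1"
  using gauss_eqI[of 1 0 n] by (simp add: qfac_def)

lemma gauss_self [simp]: "gauss n n = 1"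
  using gauss_eqI[of 1 n 0] by (simp add: qfac_def)

lemma gauss_sym: "gauss (m + n) m = gauss (m + n) n"
  by (rule gauss_eqI) (use gauss_qfac[of n m] in \<open>simp add: ac_simps\<close>)

text \<open>The q-Pascal rule. With \<open>n = k + d + 1\<close> it rests on 1 - q^(n+1) = (1 -
  q^(k+1)) + q^(k+1) (1 - q^(d+1)).\<close>

lemma gauss_Suc_Suc:
  "gauss (Suc n) (Suc k) = gauss n k + monom 1 (Suc k) * gauss n (Suc k)"
proof (cases "k < n")
  case True
  then obtain d where n: "n = k + Suc d"
    using less_iff_Suc_add by auto
  have a: "gauss n k * (qfac (Suc k) * qfac (Suc d)) = (1 - monom 1 (Suc k)) * qfac n"
    using gauss_qfac[of k "Suc d"] unfolding n qfac_Suc[of k]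
    by (metis mult.assoc mult.left_commute)
  have b: "gauss n (Suc k) * (qfac (Suc k) * qfac (Suc d)) = (1 - monom 1 (Suc d)) * qfac n"
    using gauss_qfac[of "Suc k" d] unfolding n qfac_Suc[of d]
    by (metis add_Suc_shift mult.left_commute)
  have "(gauss n k + monom 1 (Suc k) * gauss n (Suc k)) * (qfac (Suc k) * qfac (Suc d))
      = (1 - monom 1 (Suc k)) * qfac n + monom 1 (Suc k) * ((1 - monom 1 (Suc d)) * qfac n)"
    by (simp only: distrib_right mult.assoc a b)
  also have "\<dots> = (1 - monom 1 (Suc k) * monom 1 (Suc d)) * qfac n"
    by (simp add: algebra_simps)
  also have "\<dots> = qfac (Suc k + Suc d)"
    using qfac_Suc[of n] by (simp add: mult_monom n)
  finally show ?thesis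
    using gauss_eqI[of _ "Suc k" "Suc d"] n by simp
next
  case False
  then show ?thesis
    by (cases "k = n") (auto simp: gauss_eq_0)
qed

text \<open>The mirrored q-Pascal rule, obtained from the first one at the complementary lower
  index.\<close>

lemma gauss_Suc_Suc':
  assumes "k \<le> n"
  shows "gauss (Suc n) (Suc k) = gauss n (Suc k) + monom 1 (n - k) * gauss n k"
proof (cases "k = n")
  case True
  then show ?thesis by (simp add: gauss_eq_0)
next
  case False
  with assms obtain d where n: "n = k + Suc d"
    using le_neq_implies_less less_iff_Suc_add by auto
  have "gauss (Suc n) (Suc k) = gauss (Suc n) (Suc d)"
    using gauss_sym[of "Suc k" "Suc d"] n by simp
  also have "\<dots> = gauss n d + monom 1 (Suc d) * gauss n (Suc d)"
    by (rule gauss_Suc_Suc)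
  finally show ?thesis
    using gauss_sym[of "Suc k" d] gauss_sym[of k "Suc d"] n by simp
qed

text \<open>The mirrored q-Pascal rule splits the sum for \<open>k + 1\<close> into the sums for
  \<open>k\<close> with shifts \<open>r\<close> and \<open>r + 1\<close>; the first q-Pascal rule
  recombines them.\<close>

lemma gauss_vandermonde:
  "(\<Sum>i\<le>k. monom 1 (i * (i + r)) * gauss k i * gauss n (i + r)) = gauss (n + k) (k + r)"
proof (induction k arbitrary: r)
  case 0
  show ?case by simp
next
  case (Suc k)
  let ?f = "\<lambda>r i. monom 1 (i * (i + r)) * gauss k i * gauss n (i + r)"
  have step: "monom 1 (Suc i * (Suc i + r)) * gauss (Suc k) (Suc i) * gauss n (Suc i + r)
      = ?f r (Suc i) + monom 1 (Suc (k + r)) * ?f (Suc r) i" if "i \<le> k" for i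
  proof -
    \<comment> \<open>The power q^(k-i) from the mirrored rule completes the exponent so that a
      factor free of \<open>i\<close> splits off.\<close>
    have "Suc i * (Suc i + r) + (k - i) = Suc (k + r) + i * (i + Suc r)"
      using that by (simp add: algebra_simps)
    then have "monom (1::int) (Suc i * (Suc i + r)) * monom 1 (k - i)
        = monom 1 (Suc (k + r)) * monom 1 (i * (i + Suc r))"
      by (simp only: mult_monom)
    then show ?thesis
      unfolding gauss_Suc_Suc'[OF that]
      by (simp add: distrib_left distrib_right flip: mult.assoc)
  qed
  have "(\<Sum>i\<le>Suc k. monom 1 (i * (i + r)) * gauss (Suc k) i * gauss n (i + r))
      = gauss n r
        + (\<Sum>i\<le>k. monom 1 (Suc i * (Suc i + r)) * gauss (Suc k) (Suc i) * gauss n (Suc i + r))"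
    by (subst sum.atMost_Suc_shift) simp
  also have "\<dots> = gauss n r + (\<Sum>i\<le>k. ?f r (Suc i) + monom 1 (Suc (k + r)) * ?f (Suc r) i)"
    by (intro arg_cong2[where f = "(+)"] sum.cong refl step) simp
  also have "\<dots> = (\<Sum>i\<le>Suc k. ?f r i) + monom 1 (Suc (k + r)) * (\<Sum>i\<le>k. ?f (Suc r) i)"
    by (subst sum.atMost_Suc_shift) (simp only: sum.distrib sum_distrib_left, simp)
  also have "(\<Sum>i\<le>Suc k. ?f r i) = (\<Sum>i\<le>k. ?f r i)"
    by (simp add: gauss_eq_0)
  finally show ?case
    using gauss_Suc_Suc[of "n + k" "k + r"] Suc[of r] Suc[of "Suc r"] by simp
qed

text \<open>Both sides are the q-multinomial (q)_n / ((q)_i (q)_(k-i) (q)_(i+r) (q)_(n-k-i-r)), and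
  both vanish if \<open>n < k + i + r\<close>. On the right, \<open>k\<close> survives in the last
  factor only.\<close>

lemma gauss_multinomial:
  assumes "i \<le> k" "k \<le> n"
  shows "gauss n k * gauss k i * gauss (n - k) (i + r)
    = gauss n (2 * i + r) * gauss (2 * i + r) i * gauss (n - (2 * i + r)) (k - i)"
proof (cases "k + i + r \<le> n")
  case True
  then obtain d where n: "n = k + i + r + d" using le_Suc_ex by blast
  obtain e where k: "k = i + e" using assms le_Suc_ex by blast
  let ?c = "qfac i * qfac e * qfac (i + r) * qfac d"
  have eqs: "n = k + (i + r + d)" "n - k = i + r + d" "n = (2 * i + r) + (e + d)"
    "2 * i + r = i + (i + r)" "n - (2 * i + r) = e + d" "k - i = e"
    using n k by simp_all
  have "gauss n k * gauss k i * gauss (n - k) (i + r) * ?c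
      = gauss n k * ((gauss (i + e) i * (qfac i * qfac e))
        * (gauss ((i + r) + d) (i + r) * (qfac (i + r) * qfac d)))"
    using eqs k by (simp add: ac_simps)
  also have "\<dots> = gauss n k * (qfac k * qfac (i + r + d))"
    using k by (simp only: gauss_qfac)
  also have "\<dots> = qfac n"
    using gauss_qfac[of k "i + r + d"] eqs(1) by simp
  finally have l: "gauss n k * gauss k i * gauss (n - k) (i + r) * ?c = qfac n" .
  have "gauss n (2 * i + r) * gauss (2 * i + r) i * gauss (n - (2 * i + r)) (k - i) * ?c
      = gauss n (2 * i + r) * ((gauss (i + (i + r)) i * (qfac i * qfac (i + r)))
        * (gauss (e + d) e * (qfac e * qfac d)))"
    unfolding eqs(4)[symmetric] eqs(5,6) by (simp add: ac_simps)
  also have "\<dots> = gauss n (2 * i + r) * (qfac (2 * i + r) * qfac (e + d))"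
    unfolding eqs(4) by (simp only: gauss_qfac)
  also have "\<dots> = qfac n"
    using gauss_qfac[of "2 * i + r" "e + d"] eqs(3) by simp
  finally have "gauss n k * gauss k i * gauss (n - k) (i + r) * ?c
    = gauss n (2 * i + r) * gauss (2 * i + r) i * gauss (n - (2 * i + r)) (k - i) * ?c"
    using l by simp
  then show ?thesis
    using qfac_nonzero by (metis mult_cancel_right mult_eq_0_iff)
next
  case False
  then have "gauss (n - k) (i + r) = 0" using assms by (intro gauss_eq_0) simp
  moreover have "gauss n (2 * i + r) = 0 \<or> gauss (n - (2 * i + r)) (k - i) = 0"
    using False assms gauss_eq_0 by (cases "n < 2 * i + r") auto
  ultimately show ?thesis by auto
qed

text \<open>Vandermonde opens [2L, L+r], then opens [L, k+r] inside it; regrouping and setting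
  \<open>k = i + t\<close> isolates the sum over \<open>t\<close>. With s = 2i + r the outer
  exponent is (s^2 - r^2)/2, so its dependence on \<open>r\<close> at fixed s is a single power of
  q.\<close>

lemma gauss_central_expansion:
  "gauss (2 * L) (L + r) = (\<Sum>i\<le>L. monom 1 (2 * i * (i + r)) * gauss L (2 * i + r)
      * (\<Sum>t\<le>L. monom 1 (t * (t + (2 * i + r))) * gauss (L - (2 * i + r)) t) * gauss (2 * i + r) i)"
proof -
  let ?g = "\<lambda>k i. monom 1 (k * (k + r) + i * (i + r))
    * (gauss L (2 * i + r) * gauss (2 * i + r) i * gauss (L - (2 * i + r)) (k - i))"
  have inner: "monom 1 (k * (k + r)) * gauss L k * gauss L (k + r) = (\<Sum>i\<le>k. ?g k i)"
    if "k \<le> L" for k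
  proof -
    have "gauss L (k + r)
        = (\<Sum>i\<le>k. monom 1 (i * (i + r)) * gauss k i * gauss (L - k) (i + r))"
      using gauss_vandermonde[where k = k and r = r and n = "L - k"] that by simp
    then have "monom 1 (k * (k + r)) * gauss L k * gauss L (k + r)
        = (\<Sum>i\<le>k. monom 1 (k * (k + r)) * gauss L k
          * (monom 1 (i * (i + r)) * gauss k i * gauss (L - k) (i + r)))"
      by (simp only: sum_distrib_left)
    also have "\<dots> = (\<Sum>i\<le>k. monom 1 (k * (k + r) + i * (i + r))
          * (gauss L k * gauss k i * gauss (L - k) (i + r)))"
      using mult_monom[of "1::int" _ 1] by (intro sum.cong refl) (simp add: ac_simps flip: mult_monom)
    finally show ?thesis
      using gauss_multinomial[OF _ that] by simp
  qed
  have "gauss (2 * L) (L + r) = (\<Sum>k\<le>L. monom 1 (k * (k + r)) * gauss L k * gauss L (k + r))"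
    using gauss_vandermonde[where k = L and r = r and n = L] by (simp add: mult_2)
  also have "\<dots> = (\<Sum>k\<le>L. \<Sum>i\<le>k. ?g k i)"
    using inner by simp
  also have "\<dots> = (\<Sum>(i, t) \<in> {(i, t). i + t \<le> L}. ?g (i + t) i)"
    unfolding sum.triangle_reindex_eq by simp
  \<comment> \<open>Filling the triangle up to a square adds only zeros: if
    \<open>i + t > L\<close>, then either \<open>2 * i + r > L\<close> or
    \<open>t > L - (2 * i + r)\<close>.\<close>
  also have "\<dots> = (\<Sum>(i, t) \<in> {..L} \<times> {..L}. ?g (i + t) i)"
  proof (intro sum.mono_neutral_left ballI)
    fix x assume x: "x \<in> {..L} \<times> {..L} - {(i, t). i + t \<le> L}"
    obtain i t where "x = (i, t)" by fastforce
    with x show "(case x of (i, t) \<Rightarrow> ?g (i + t) i) = 0"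
      by (cases "L < 2 * i + r") (auto simp: gauss_eq_0)
  qed auto
  also have "\<dots> = (\<Sum>i\<le>L. \<Sum>t\<le>L. ?g (i + t) i)"
    by (rule sum.cartesian_product[symmetric])
  also have "\<dots> = (\<Sum>i\<le>L. monom 1 (2 * i * (i + r)) * gauss L (2 * i + r)
      * (\<Sum>t\<le>L. monom 1 (t * (t + (2 * i + r))) * gauss (L - (2 * i + r)) t) * gauss (2 * i + r) i)"
  proof (rule sum.cong[OF refl])
    fix i
    have "?g (i + t) i = monom 1 (2 * i * (i + r)) * gauss L (2 * i + r)
      * (monom 1 (t * (t + (2 * i + r))) * gauss (L - (2 * i + r)) t) * gauss (2 * i + r) i" for t
    proof -
      have "(i + t) * (i + t + r) + i * (i + r) = 2 * i * (i + r) + t * (t + (2 * i + r))"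
        by (simp add: algebra_simps)
      then have "monom (1::int) ((i + t) * (i + t + r) + i * (i + r))
          = monom 1 (2 * i * (i + r)) * monom 1 (t * (t + (2 * i + r)))"
        by (simp only: mult_monom) simp
      then show ?thesis by (simp only:) (simp add: ac_simps)
    qed
    then show "(\<Sum>t\<le>L. ?g (i + t) i) = monom 1 (2 * i * (i + r)) * gauss L (2 * i + r)
      * (\<Sum>t\<le>L. monom 1 (t * (t + (2 * i + r))) * gauss (L - (2 * i + r)) t) * gauss (2 * i + r) i"
      by (simp only: sum_distrib_left sum_distrib_right)
  qed
  finally show ?thesis .
qed

section \<open>Recurrences for q-binomials with an integer lower index\<close>

lemma qbinom_of_nat: "qbinom (int n) B = (if 0 \<le> B then gauss n (nat B) else 0)"
  by (simp add: gauss_def qbinom_def)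

lemma qbinom_eq_0: "B < 0 \<or> A < B \<Longrightarrow> qbinom A B = 0"
  by (auto simp: qbinom_def)

lemma qbinom_sym: "qbinom A (A - B) = qbinom A B"
  by (simp add: qbinom_def mult.commute)

text \<open>Truncation in \<open>nat B\<close> does no harm: for negative \<open>B\<close> the
  factor it multiplies is zero.\<close>

lemma qbinom_Suc:
  "qbinom (int (Suc n)) B = qbinom (int n) (B - 1) + monom 1 (nat B) * qbinom (int n) B"
proof (cases "B \<le> 0")
  case True
  then show ?thesis
    by (cases "B = 0") (simp_all add: qbinom_of_nat del: of_nat_Suc)
next
  case False
  then obtain b where b: "B = int (Suc b)"
    by (metis gr0_conv_Suc linorder_not_less zero_less_imp_eq_int)
  then have "B - 1 = int b" by simp
  then show ?thesis
    unfolding b using gauss_Suc_Suc[of n b] by (simp only: gauss_def nat_int)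
qed

lemma qbinom_Suc':
  "qbinom (int (Suc n)) B
    = qbinom (int n) B + monom 1 (nat (int (Suc n) - B)) * qbinom (int n) (B - 1)"
  using qbinom_Suc[of n "int (Suc n) - B"] qbinom_sym[of "int (Suc n)" B] qbinom_sym[of "int n" B]
    qbinom_sym[of "int n" "B - 1"]
  by (simp add: algebra_simps)

text \<open>One Pascal step of each kind, so that the upper index \<open>2 * m + 1\<close> can
  advance with \<open>m\<close>. The two powers meeting in the middle term combine to q^(n+1),
  whatever \<open>B\<close> is.\<close>

lemma qbinom_Suc_Suc:
  "qbinom (int (Suc (Suc n))) B = (1 + monom 1 (Suc n)) * qbinom (int n) (B - 1)
    + monom 1 (nat B) * qbinom (int n) B
    + monom 1 (nat (int (Suc (Suc n)) - B)) * qbinom (int n) (B - 2)"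
proof -
  have *: "monom 1 (nat B) * (monom 1 (nat (int (Suc n) - B)) * qbinom (int n) (B - 1))
      = monom 1 (Suc n) * qbinom (int n) (B - 1)"
  proof (cases "1 \<le> B \<and> B \<le> int n + 1")
    case True
    then have "nat B + nat (int (Suc n) - B) = Suc n" by linarith
    then show ?thesis by (simp only: mult.assoc[symmetric] mult_monom) simp
  qed (auto simp: qbinom_eq_0)
  have "int (Suc n) - (B - 1) = int (Suc (Suc n)) - B" "B - 1 - 1 = B - 2" by simp_all
  then show ?thesis
    unfolding qbinom_Suc[of "Suc n" B] qbinom_Suc'[of n B] qbinom_Suc'[of n "B - 1"] distrib_left *
    by (simp only: distrib_right)
qed

section \<open>An alternating sum of period three\<close>

text \<open>
  Up to sign and power of \<open>z\<close>, these are the coefficients of the finite Jacobi triple product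
  of length \<open>2 m + 1\<close>. Passing from \<open>m\<close> to \<open>m + 1\<close> multiplies it by
  \<open>(1 - q^(m + 1) / z) (1 - z q^(m + 1))\<close>, which is the recurrence \<open>alt_term_Suc\<close>.
\<close>

definition alt_term :: "nat \<Rightarrow> int \<Rightarrow> int poly" where
  "alt_term m k = (-1) ^ nat \<bar>k\<bar> * monom 1 (nat (k * (k + 1) div 2)) * qbinom (int (2 * m + 1)) (int m - k)"

lemma minus_one_power_nat_abs:
  "(-1) ^ nat \<bar>k\<bar> = (if even k then 1 else - 1 :: 'a :: ring_1)"
  by (auto simp: even_nat_iff minus_one_power_iff)

lemma finite_alt_term: "finite {j. alt_term m (3 * j + c) \<noteq> 0}"
proof (rule finite_subset)
  show "{j. alt_term m (3 * j + c) \<noteq> 0} \<subseteq> (\<lambda>j. 3 * j + c) -` {- int m - 1..int m}"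
    by (auto simp: alt_term_def qbinom_def split: if_splits)
  show "finite ((\<lambda>j. 3 * j + c) -` {- int m - 1..int m})"
    by (intro finite_vimageI) (auto simp: inj_on_def)
qed

text \<open>The map k to -1 - k preserves k(k+1)/2 and exchanges complementary lower indices, but
  flips the parity of k.\<close>

lemma alt_term_reflect: "alt_term m (- 1 - k) = - alt_term m k"
proof -
  have "int m - (- 1 - k) = int (2 * m + 1) - (int m - k)" by simp
  then have "qbinom (int (2 * m + 1)) (int m - (- 1 - k)) = qbinom (int (2 * m + 1)) (int m - k)"
    using qbinom_sym by metis
  moreover have "(- 1 - k) * (- 1 - k + 1) = k * (k + 1)" by (simp add: algebra_simps)
  ultimately show ?thesis
    unfolding alt_term_def minus_one_power_nat_abs by simp
qed

lemma alt_term_Suc: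
  "alt_term (Suc m) k = (1 + monom 1 (2 * Suc m)) * alt_term m k
    - monom 1 (Suc m) * (alt_term m (k - 1) + alt_term m (k + 1))"
proof -
  define T where "T = (\<lambda>k :: int. nat (k * (k + 1) div 2))"
  have T2: "2 * int (T k) = k * (k + 1)" for k
  proof -
    have "0 \<le> k * (k + 1)" by (cases "0 \<le> k") (auto simp: zero_le_mult_iff)
    then show ?thesis by (simp add: T_def)
  qed
  let ?n = "2 * m + 1"
  let ?Q = "qbinom (int ?n)"
  define s :: "int poly" where "s = (-1) ^ nat \<bar>k\<bar>"
  have s: "(-1) ^ nat \<bar>k - 1\<bar> = - s" "(-1) ^ nat \<bar>k + 1\<bar> = - s"
    unfolding s_def minus_one_power_nat_abs by auto
  \<comment> \<open>Since T(k) - T(k-1) = k, the outer Pascal powers turn into the uniform factor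
    q^(m+1) once the triangular exponent is moved to the neighbouring index; \<open>r\<close> is the
    same on the other side.\<close>
  have l: "monom 1 (T k) * (monom 1 (nat (int m + 1 - k)) * ?Q (int m + 1 - k))
      = monom 1 (Suc m) * (monom 1 (T (k - 1)) * ?Q (int m - (k - 1)))"
  proof (cases "0 \<le> int m + 1 - k")
    case True
    then have "T k + nat (int m + 1 - k) = Suc m + T (k - 1)"
      using T2[of k] T2[of "k - 1"] by (simp add: algebra_simps)
    then show ?thesis
      by (simp only: mult.assoc[symmetric] mult_monom) (simp add: algebra_simps)
  qed (simp add: qbinom_eq_0)
  have r: "monom 1 (T k) * (monom 1 (nat (int m + 2 + k)) * ?Q (int m - 1 - k))
      = monom 1 (Suc m) * (monom 1 (T (k + 1)) * ?Q (int m - (k + 1)))"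
  proof (cases "0 \<le> int m + 2 + k")
    case True
    then have "T k + nat (int m + 2 + k) = Suc m + T (k + 1)"
      using T2[of k] T2[of "k + 1"] by (simp add: algebra_simps)
    then show ?thesis
      by (simp only: mult.assoc[symmetric] mult_monom) (simp add: algebra_simps)
  qed (simp add: qbinom_eq_0)
  have "qbinom (int (2 * Suc m + 1)) (int (Suc m) - k) = (1 + monom 1 (2 * Suc m)) * ?Q (int m - k)
      + monom 1 (nat (int m + 1 - k)) * ?Q (int m + 1 - k)
      + monom 1 (nat (int m + 2 + k)) * ?Q (int m - 1 - k)"
  proof -
    have "int (Suc (Suc ?n)) - (int m + 1 - k) = int m + 2 + k" "int m + 1 - k - 1 = int m - k"
      "int m + 1 - k - 2 = int m - 1 - k" "Suc (Suc ?n) = 2 * Suc m + 1"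
      "Suc ?n = 2 * Suc m" "int (Suc m) - k = int m + 1 - k"
      by simp_all
    then show ?thesis using qbinom_Suc_Suc[of ?n "int m + 1 - k"] by (simp only:)
  qed
  then have "alt_term (Suc m) k = s * ((1 + monom 1 (2 * Suc m)) * (monom 1 (T k) * ?Q (int m - k))
      + monom 1 (T k) * (monom 1 (nat (int m + 1 - k)) * ?Q (int m + 1 - k))
      + monom 1 (T k) * (monom 1 (nat (int m + 2 + k)) * ?Q (int m - 1 - k)))"
    unfolding alt_term_def s_def[symmetric] T_def by (simp only: distrib_left) (simp only: ac_simps)
  also have "\<dots> = (1 + monom 1 (2 * Suc m)) * (s * monom 1 (T k) * ?Q (int m - k))
      - monom 1 (Suc m) * (- s * monom 1 (T (k - 1)) * ?Q (int m - (k - 1))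
          + - s * monom 1 (T (k + 1)) * ?Q (int m - (k + 1)))"
    unfolding l r by (simp only: distrib_left distrib_right) (simp add: ac_simps)
  finally show ?thesis
    unfolding alt_term_def s s_def[symmetric] T_def .
qed

text \<open>By the recurrence and the reflection, each step multiplies the sum by 1 + q^(m+1) +
  q^(2(m+1)). This factor is (1 - w q^(m+1)) (1 - q^(m+1)/w) for a primitive cube root of unity
  w.\<close>

lemma Sum_any_alt_term:
  "(\<Sum>j. alt_term m (3 * j)) = (\<Prod>i=1..m. 1 + monom 1 i + monom 1 (2 * i))"
proof (induction m)
  case 0
  have "alt_term 0 (3 * j) = (if j = 0 then 1 else 0)" for j
    by (simp add: alt_term_def qbinom_eq_0 gauss_eq_0 qbinom_of_nat[of 1, simplified])
  then show ?case by simp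
next
  case (Suc m)
  let ?S = "\<lambda>c. (\<Sum>j. alt_term m (3 * j + c))"
  \<comment> \<open>The reflection \<open>k \<mapsto> - 1 - k\<close> fixes the class of 1 modulo 3 and swaps the other two.\<close>
  have S1: "?S 1 = 0"
  proof -
    have "?S 1 = (\<Sum>j. - alt_term m (3 * j + 1))"
    proof (rule Sum_any.reindex_cong)
      show "bij (\<lambda>j :: int. - 1 - j)" by (rule bij_betw_byWitness[of _ "\<lambda>j. - 1 - j"]) auto
      show "(\<lambda>j. alt_term m (3 * j + 1)) \<circ> (\<lambda>j. - 1 - j) = (\<lambda>j. - alt_term m (3 * j + 1))"
        unfolding alt_term_reflect[symmetric] by (simp add: fun_eq_iff algebra_simps)
    qed
    also have "\<dots> = - ?S 1"
      using Sum_any_right_distrib[OF finite_alt_term[of m 1], of "- 1"] by simp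
    finally show ?thesis by (simp add: poly_eq_iff)
  qed
  have S2: "?S (- 1) = - ?S 0"
  proof -
    have "?S (- 1) = (\<Sum>j. - alt_term m (3 * j + 0))"
    proof (rule Sum_any.reindex_cong)
      show "bij (\<lambda>j :: int. - j)" by (rule bij_betw_byWitness[of _ uminus]) auto
      show "(\<lambda>j. alt_term m (3 * j + - 1)) \<circ> uminus = (\<lambda>j. - alt_term m (3 * j + 0))"
        unfolding alt_term_reflect[symmetric]
        by (intro ext) (simp, intro arg_cong[where f = "alt_term m"], simp)
    qed
    also have "\<dots> = - ?S 0"
      using Sum_any_right_distrib[OF finite_alt_term[of m 0], of "- 1"] by simp
    finally show ?thesis .
  qed
  note fin = finite_alt_term[of m]
  note fin0 = fin[of 0, simplified] and fin1 = fin[of 1] and fin2 = fin[of "- 1", simplified]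
  \<comment> \<open>By \<open>alt_term_Suc\<close> this set also contains the support at
    \<open>Suc m\<close>, so all four infinite sums reduce to one finite range.\<close>
  define N where "N = {j. alt_term m (3 * j) \<noteq> 0} \<union> {j. alt_term m (3 * j + 1) \<noteq> 0}
    \<union> {j. alt_term m (3 * j - 1) \<noteq> 0}"
  have N: "finite N" using fin0 fin1 fin2 by (simp add: N_def)
  have "(\<Sum>j. alt_term (Suc m) (3 * j)) = (\<Sum>j\<in>N. alt_term (Suc m) (3 * j))"
    by (rule Sum_any.expand_superset[OF N]) (auto simp: N_def alt_term_Suc)
  also have "\<dots> = (1 + monom 1 (2 * Suc m)) * (\<Sum>j\<in>N. alt_term m (3 * j))
    - monom 1 (Suc m) * ((\<Sum>j\<in>N. alt_term m (3 * j - 1)) + (\<Sum>j\<in>N. alt_term m (3 * j + 1)))"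
    unfolding alt_term_Suc by (simp only: sum_subtractf flip: sum.distrib sum_distrib_left)
  also have "(\<Sum>j\<in>N. alt_term m (3 * j)) = ?S 0"
    by (subst Sum_any.expand_superset[OF N]) (auto simp: N_def)
  also have "(\<Sum>j\<in>N. alt_term m (3 * j - 1)) = ?S (- 1)"
    by (subst Sum_any.expand_superset[OF N]) (auto simp: N_def)
  also have "(\<Sum>j\<in>N. alt_term m (3 * j + 1)) = ?S 1"
    by (subst Sum_any.expand_superset[OF N]) (auto simp: N_def)
  finally have "(\<Sum>j. alt_term (Suc m) (3 * j)) = (1 + monom 1 (Suc m) + monom 1 (2 * Suc m)) * ?S 0"
    unfolding S1 S2 by (simp only: distrib_right) (simp add: algebra_simps)
  then show ?case using Suc by (simp add: mult.commute)
qed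

section \<open>Doubling the index\<close>

text \<open>The coefficient of \<open>gauss_central_expansion\<close> at s = 2i + r = 2m + 1,
  multiplied by q^((r^2-1)/2). The leading exponent becomes (s^2 - 1)/2 = 2m(m+1), which is free of
  r.\<close>

definition doubling_kernel :: "nat \<Rightarrow> nat \<Rightarrow> int poly" where
  "doubling_kernel L m = monom 1 (2 * m * (m + 1)) * gauss L (2 * m + 1)
    * (\<Sum>t\<le>L. monom 1 (t * (t + (2 * m + 1))) * gauss (L - (2 * m + 1)) t)"

lemma doubling_nat:
  "(\<Sum>m\<le>L. doubling_kernel L m * qbinom (int (2 * m + 1)) (int m - int j))
    = monom 1 (2 * j * (j + 1)) * qbinom (int (2 * L)) (int L - 1 - 2 * int j)"
proof -
  let ?h = "\<lambda>m. doubling_kernel L m * qbinom (int (2 * m + 1)) (int m - int j)"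
  have h: "?h (i + j) = monom 1 (2 * j * (j + 1)) * (monom 1 (2 * i * (i + (2 * j + 1)))
      * gauss L (2 * i + (2 * j + 1))
      * (\<Sum>t\<le>L. monom 1 (t * (t + (2 * i + (2 * j + 1)))) * gauss (L - (2 * i + (2 * j + 1))) t)
      * gauss (2 * i + (2 * j + 1)) i)" for i
  proof -
    have "2 * (i + j) * (i + j + 1) = 2 * j * (j + 1) + 2 * i * (i + (2 * j + 1))"
      by (simp add: algebra_simps)
    then have "monom (1::int) (2 * (i + j) * (i + j + 1))
        = monom 1 (2 * j * (j + 1)) * monom 1 (2 * i * (i + (2 * j + 1)))"
      by (simp only: mult_monom) simp
    moreover have "2 * (i + j) + 1 = 2 * i + (2 * j + 1)" "int (i + j) - int j = int i" by simp_all
    ultimately show ?thesis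
      unfolding doubling_kernel_def by (simp only: gauss_def mult.assoc)
  qed
  \<comment> \<open>Terms with \<open>m < j\<close> have a negative lower index, and terms with
    \<open>m > L\<close> have a zero kernel; the shift \<open>m = i + j\<close> then matches the
    expansion with r = 2j + 1.\<close>
  have "(\<Sum>m\<le>L. ?h m) = (\<Sum>m\<in>{j..L + j}. ?h m)"
  proof (rule sum.mono_neutral_cong)
    fix m assume "m \<in> {j..L + j} - {..L}"
    then show "?h m = 0" by (simp add: doubling_kernel_def gauss_eq_0)
  next
    fix m assume "m \<in> {..L} - {j..L + j}"
    then show "?h m = 0" by (auto simp: qbinom_eq_0)
  qed auto
  also have "\<dots> = (\<Sum>i\<le>L. ?h (i + j))"
    using sum.shift_bounds_cl_nat_ivl[of ?h 0 j L] by (simp add: atMost_atLeast0)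
  also have "\<dots> = monom 1 (2 * j * (j + 1)) * gauss (2 * L) (L + (2 * j + 1))"
    unfolding h gauss_central_expansion by (simp only: sum_distrib_left)
  also have "gauss (2 * L) (L + (2 * j + 1)) = qbinom (int (2 * L)) (int L - 1 - 2 * int j)"
    using qbinom_sym[of "int (2 * L)" "int (L + (2 * j + 1))"] by (simp add: gauss_def algebra_simps)
  finally show ?thesis .
qed

text \<open>Replacing j by -1 - j fixes 2j(j+1) and both q-binomials, which reduces negative j to
  the natural case.\<close>

lemma doubling:
  "(\<Sum>m\<le>L. doubling_kernel L m * qbinom (int (2 * m + 1)) (int m - j))
    = monom 1 (nat (2 * j * (j + 1))) * qbinom (int (2 * L)) (int L - 1 - 2 * j)"
proof (cases "0 \<le> j")
  case True
  then obtain i where i: "j = int i" using nonneg_int_cases by blast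
  have "nat (2 * j * (j + 1)) = 2 * i * (i + 1)"
    unfolding i by (simp add: nat_mult_distrib nat_add_distrib)
  then show ?thesis using doubling_nat[of L i] i by simp
next
  case False
  then obtain i where "- 1 - j = int i"
    using nonneg_int_cases[of "- 1 - j"] by auto
  then have i: "j = - 1 - int i" by simp
  have "nat (2 * j * (j + 1)) = 2 * i * (i + 1)"
    unfolding i by (rule nat_eq_iff[THEN iffD2]) (simp add: algebra_simps)
  moreover have "qbinom (int (2 * m + 1)) (int m - j) = qbinom (int (2 * m + 1)) (int m - int i)" for m
    using qbinom_sym[of "int (2 * m + 1)" "int m - j"] by (simp add: i algebra_simps)
  moreover have "qbinom (int (2 * L)) (int L - 1 - 2 * j) = qbinom (int (2 * L)) (int L - 1 - 2 * int i)"
    using qbinom_sym[of "int (2 * L)" "int L - 1 - 2 * j"] by (simp add: i algebra_simps)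
  ultimately show ?thesis using doubling_nat[of L i] by (simp only:)
qed

section \<open>Formal powers and positivity\<close>

lemma qexpr_of_poly_eq:
  assumes "degree p \<le> N"
  shows "qexpr_of_poly p = (\<Sum>i\<le>N. Poly_Mapping.single (of_nat i) (coeff p i))"
  unfolding qexpr_of_poly_def
  using assms by (intro sum.mono_neutral_left) (auto simp: coeff_eq_0)

lemma qexpr_of_poly_0 [simp]: "qexpr_of_poly 0 = 0"
  by (simp add: qexpr_of_poly_def)

lemma qexpr_of_poly_add: "qexpr_of_poly (p + r) = qexpr_of_poly p + qexpr_of_poly r"
proof -
  let ?N = "max (degree p) (degree r)"
  show ?thesis
    using qexpr_of_poly_eq[of "p + r" ?N] qexpr_of_poly_eq[of p ?N] qexpr_of_poly_eq[of r ?N]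
    by (simp add: degree_add_le single_add sum.distrib)
qed

lemma qexpr_of_poly_sum: "qexpr_of_poly (sum f A) = (\<Sum>x\<in>A. qexpr_of_poly (f x))"
  by (induction A rule: infinite_finite_induct) (simp_all add: qexpr_of_poly_add)

lemma qexpr_of_poly_monom: "qexpr_of_poly (monom c n) = Poly_Mapping.single (of_nat n) c"
proof -
  have "qexpr_of_poly (monom c n)
      = (\<Sum>i\<le>n. if i = n then Poly_Mapping.single (of_nat n) c else 0)"
    by (subst qexpr_of_poly_eq[OF degree_monom_le]) (intro sum.cong refl, auto)
  then show ?thesis by simp
qed

text \<open>Once an exponent is known to be a natural number, the computation can move from formal
  powers to polynomials.\<close>

lemma single_mult_qexpr_of_poly:
  "Poly_Mapping.single (of_nat n) c * qexpr_of_poly p = qexpr_of_poly (monom c n * p)"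
proof -
  have "qexpr_of_poly (monom c n * p) = qexpr_of_poly (\<Sum>i\<le>degree p. monom c n * monom (coeff p i) i)"
    by (subst (1) poly_as_sum_of_monoms[symmetric]) (simp only: sum_distrib_left)
  also have "\<dots> = Poly_Mapping.single (of_nat n) c * qexpr_of_poly p"
    unfolding qexpr_of_poly_sum qexpr_of_poly_def[of p]
    by (simp add: mult_monom qexpr_of_poly_monom sum_distrib_left mult_single)
  finally show ?thesis by simp
qed

section \<open>Closure properties of nonnegative coefficients\<close>

definition nonneg_coeffs :: "int poly \<Rightarrow> bool" where
  "nonneg_coeffs p \<longleftrightarrow> (\<forall>i. coeff p i \<ge> 0)"

lemma nonneg_coeffs_add: "nonneg_coeffs p \<Longrightarrow> nonneg_coeffs r \<Longrightarrow> nonneg_coeffs (p + r)"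
  by (simp add: nonneg_coeffs_def)

lemma nonneg_coeffs_mult: "nonneg_coeffs p \<Longrightarrow> nonneg_coeffs r \<Longrightarrow> nonneg_coeffs (p * r)"
  by (simp add: nonneg_coeffs_def coeff_mult sum_nonneg)

lemma nonneg_coeffs_monom: "0 \<le> c \<Longrightarrow> nonneg_coeffs (monom c n)"
  by (simp add: nonneg_coeffs_def)

lemma nonneg_coeffs_0: "nonneg_coeffs 0" and nonneg_coeffs_1: "nonneg_coeffs 1"
  by (simp_all add: nonneg_coeffs_def)

lemma nonneg_coeffs_sum: "(\<And>x. x \<in> A \<Longrightarrow> nonneg_coeffs (f x)) \<Longrightarrow> nonneg_coeffs (sum f A)"
  by (simp add: nonneg_coeffs_def coeff_sum sum_nonneg)

lemma nonneg_coeffs_prod: "(\<And>x. x \<in> A \<Longrightarrow> nonneg_coeffs (f x)) \<Longrightarrow> nonneg_coeffs (prod f A)"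
  by (induction A rule: infinite_finite_induct) (auto simp: nonneg_coeffs_1 nonneg_coeffs_mult)

text \<open>The quotient of factorials hides the signs; the q-Pascal rule contains no
  subtraction.\<close>

lemma nonneg_coeffs_gauss: "nonneg_coeffs (gauss n k)"
proof (induction n arbitrary: k)
  case 0
  show ?case by (cases k) (simp_all add: gauss_eq_0 nonneg_coeffs_0 nonneg_coeffs_1)
next
  case (Suc n)
  then show ?case
    by (cases k) (simp_all add: gauss_Suc_Suc nonneg_coeffs_1 nonneg_coeffs_add
      nonneg_coeffs_mult nonneg_coeffs_monom)
qed

lemma nonneg_coeffs_doubling_kernel: "nonneg_coeffs (doubling_kernel L m)"
  unfolding doubling_kernel_def
  by (intro nonneg_coeffs_mult nonneg_coeffs_sum nonneg_coeffs_monom nonneg_coeffs_gauss) simp_all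

section \<open>Expansion of the terms of \<open>G\<close> and conclusion\<close>

lemma G_term_eq:
  fixes L :: nat
  shows "Poly_Mapping.single
       (of_int 6 * of_int j * (((5 + 5/2) * of_int j + (5 - 5/2)) / 2)) ((-1) ^ nat \<bar>j\<bar>)
     * qexpr_of_poly (qbinom (int L - 1 + (int L + 1)) (int L - 1 - 6 * j))
    = qexpr_of_poly (\<Sum>m\<le>L. doubling_kernel L m * alt_term m (3 * j))"
proof -
  \<comment> \<open>In terms of k the exponent 15j(3j+1)/2 is 5k(k+1)/2. It splits into
    \<open>d\<close>, which \<open>doubling\<close> absorbs, and the triangular number
    \<open>e\<close>, which \<open>alt_term\<close> needs.\<close>
  define k where "k = 3 * j"
  define e where "e = nat (k * (k + 1) div 2)"
  have pos: "0 \<le> k * (k + 1)" by (cases "0 \<le> k") (auto simp: zero_le_mult_iff)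
  have e: "2 * int e = k * (k + 1)" using pos by (simp add: e_def)
  define d where "d = nat (2 * k * (k + 1))"
  have d: "int d = 2 * k * (k + 1)" using pos by (simp add: d_def mult.assoc)
  have "rat_of_int (2 * int (d + e)) = rat_of_int (5 * (k * (k + 1)))"
    using d e by (simp add: algebra_simps)
  then have exp: "of_int 6 * of_int j * (((5 + 5/2) * of_int j + (5 - 5/2)) / 2) = rat_of_nat (d + e)"
    by (simp add: k_def field_simps)
  \<comment> \<open>The sign (-1)^j may be replaced by (-1)^k because 3 is odd.\<close>
  have parity: "even j \<longleftrightarrow> even k" by (simp add: k_def)
  have "monom ((-1) ^ nat \<bar>j\<bar>) (d + e) = (-1) ^ nat \<bar>k\<bar> * monom 1 e * monom (1 :: int) d"
    unfolding minus_one_power_nat_abs parity by (simp add: mult_monom minus_monom add.commute)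
  then have "monom ((-1) ^ nat \<bar>j\<bar>) (d + e) * qbinom (int (2 * L)) (int L - 1 - 2 * k)
      = (-1) ^ nat \<bar>k\<bar> * monom 1 e
        * (\<Sum>m\<le>L. doubling_kernel L m * qbinom (int (2 * m + 1)) (int m - k))"
    unfolding doubling d_def[symmetric] by (simp only: mult.assoc)
  also have "\<dots> = (\<Sum>m\<le>L. doubling_kernel L m * alt_term m k)"
    unfolding alt_term_def e_def[symmetric] sum_distrib_left
    by (intro sum.cong refl) (simp only: ac_simps)
  finally have "monom ((-1) ^ nat \<bar>j\<bar>) (d + e) * qbinom (int (2 * L)) (int L - 1 - 2 * k)
      = (\<Sum>m\<le>L. doubling_kernel L m * alt_term m k)" .
  then show ?thesis
    unfolding exp single_mult_qexpr_of_poly by (simp add: k_def)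
qed

theorem mainTheorem14:
  fixes L :: int
  assumes "L \<ge> 1"
  shows "nonneg_polynomial (G (L - 1) (L + 1) 5 (5/2) 6)"
proof -
  define l where "l = nat L"
  have L: "L = int l" using assms by (simp add: l_def)
  \<comment> \<open>A single finite range covering the supports for every \<open>m\<close> up to
    \<open>l\<close> allows the sums over \<open>j\<close> and \<open>m\<close> to be
    exchanged.\<close>
  define N where "N = (\<Union>m\<le>l. {j. alt_term m (3 * j) \<noteq> 0})"
  have N: "finite N" using finite_alt_term[of _ 0] by (simp add: N_def)
  let ?f = "\<lambda>j. \<Sum>m\<le>l. doubling_kernel l m * alt_term m (3 * j)"
  let ?P = "\<Sum>m\<le>l. doubling_kernel l m * (\<Prod>i=1..m. 1 + monom 1 i + monom 1 (2 * i))"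
  have f: "?f j = 0" if "j \<notin> N" for j
    using that by (auto simp: N_def intro!: sum.neutral)
  have "G (L - 1) (L + 1) 5 (5/2) 6 = (\<Sum>j. qexpr_of_poly (?f j))"
    unfolding G_def L using G_term_eq[of _ l] by (intro Sum_any.cong) simp
  also have "\<dots> = (\<Sum>j\<in>N. qexpr_of_poly (?f j))"
    by (rule Sum_any.expand_superset[OF N]) (use f in fastforce)
  also have "\<dots> = qexpr_of_poly (\<Sum>j\<in>N. ?f j)"
    by (simp only: qexpr_of_poly_sum)
  also have "(\<Sum>j\<in>N. ?f j) = (\<Sum>m\<le>l. doubling_kernel l m * (\<Sum>j\<in>N. alt_term m (3 * j)))"
    by (subst sum.swap) (simp only: sum_distrib_left)
  also have "\<dots> = ?P"
  proof (intro sum.cong refl arg_cong[where f = "(*) _"])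
    fix m assume "m \<in> {..l}"
    then have "{j. alt_term m (3 * j) \<noteq> 0} \<subseteq> N" by (auto simp: N_def)
    then show "(\<Sum>j\<in>N. alt_term m (3 * j)) = (\<Prod>i=1..m. 1 + monom 1 i + monom 1 (2 * i))"
      using Sum_any.expand_superset[OF N] Sum_any_alt_term by metis
  qed
  finally have "G (L - 1) (L + 1) 5 (5/2) 6 = qexpr_of_poly ?P" .
  moreover have "nonneg_coeffs ?P"
    by (intro nonneg_coeffs_sum nonneg_coeffs_mult nonneg_coeffs_doubling_kernel nonneg_coeffs_prod
        nonneg_coeffs_add nonneg_coeffs_monom nonneg_coeffs_1) simp_all
  ultimately show ?thesis
    unfolding nonneg_polynomial_def nonneg_coeffs_def by blast
qed

end
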